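(* Let $f \colon \mathbb{R}^n \to \mathbb{R}$ be $L$-smooth and $\mu$-strongly convex with respect to the given inner product, with $0 < \mu \le L$, and let $x^*$ be its unique global minimizer. Let $x, d \in \mathbb{R}^n$, and assume that for some $\theta \in [0,\pi/2)$ and some $c > 0$, \[ \langle \nabla f(x), d\rangle = \cos\theta\, \|\nabla f(x)\|\,\|d\| \qquad\text{and}\qquad \|d\| = c\,\|\nabla f(x)\|. \] Define \[ \bar h = \frac{2\cos\theta}{L c(1+\sin\theta) + \mu c(1-\sin\theta)}. \] Then for $0 \le h \le \bar h$ the point $x^+ = x - hd$ satisfies \[ f(x^+) - f(x^* ) \le \left(1 - \frac{h\mu c(1-\sin\theta)}{\cos\theta}\right)^2 (f(x) - f(x^* )). \] In particular, the step size $h = \bar h$ yields \[ f(x^+) - f(x^* ) \le \left(\frac{\kappa_{f,\theta}-1}{\kappa_{f,\theta}+1}\right)^2 (f(x) - f(x^* )), \qquad \kappa_{f,\theta} = \frac{L}{\mu}\left(\frac{1+\sin\theta}{1-\sin\theta}\right). \]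
   Context: $\mathbb{R}^n$ is equipped with an arbitrary fixed inner product $\langle \cdot,\cdot\rangle$ with corresponding norm $\|\cdot\|$, and $\nabla f$ denotes the gradient of the differentiable function $f$ with respect to this inner product. The function $f$ is $L$-smooth if $\|\nabla f(x) - \nabla f(y)\| \le L\|x-y\|$ for all $x,y \in \mathbb{R}^n$, and $\mu$-strongly convex if $f(x) \ge f(y) + \langle \nabla f(y), x-y\rangle + \frac{\mu}{2}\|x-y\|^2$ for all $x,y\in\mathbb{R}^n$. *)

theory Defs
  imports "HOL-Analysis.Analysis"
begin

text \<open>
  The inner product on \<open>\<real>\<^sup>n\<close> is arbitrary, so it is an explicit argument \<open>ip\<close>
  and not the dot product of the type class. All norms on \<open>\<real>\<^sup>n\<close> are equivalent, so
  \<open>has_derivative\<close> does not depend on \<open>ip\<close>; the gradient does.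
\<close>

definition is_inner_product :: "(real ^ 'n \<Rightarrow> real ^ 'n \<Rightarrow> real) \<Rightarrow> bool" where
  "is_inner_product ip \<longleftrightarrow>
     bilinear ip \<and> (\<forall>x y. ip x y = ip y x) \<and> (\<forall>x. x \<noteq> 0 \<longrightarrow> 0 < ip x x)"

definition ip_norm :: "(real ^ 'n \<Rightarrow> real ^ 'n \<Rightarrow> real) \<Rightarrow> real ^ 'n \<Rightarrow> real" where
  "ip_norm ip x = sqrt (ip x x)"

definition gradient ::
  "(real ^ 'n \<Rightarrow> real ^ 'n \<Rightarrow> real) \<Rightarrow> (real ^ 'n \<Rightarrow> real) \<Rightarrow> real ^ 'n \<Rightarrow> real ^ 'n" where
  "gradient ip f x = (THE g. (f has_derivative (\<lambda>v. ip g v)) (at x))"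

lemma gradient_eqI:
  assumes ip: "is_inner_product ip" and g: "(f has_derivative (\<lambda>v. ip g v)) (at x)"
  shows "gradient ip f x = g"
  unfolding gradient_def
proof (rule the_equality)
  fix g' assume "(f has_derivative (\<lambda>v. ip g' v)) (at x)"
  then have eq: "(\<lambda>v. ip g' v) = (\<lambda>v. ip g v)"
    using g by (rule has_derivative_unique)
  have "bilinear ip" using ip by (simp add: is_inner_product_def)
  then have "ip (g' - g) (g' - g) = ip g' (g' - g) - ip g (g' - g)"
    by (rule bilinear_lsub)
  then have "\<not> 0 < ip (g' - g) (g' - g)" by (simp add: fun_cong[OF eq])
  moreover have "g' - g \<noteq> 0 \<longrightarrow> 0 < ip (g' - g) (g' - g)"
    using ip unfolding is_inner_product_def by blast
  ultimately show "g' = g" by simp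
qed (fact g)

lemma has_derivative_gradient:
  fixes ip :: "real ^ 'n \<Rightarrow> real ^ 'n \<Rightarrow> real"
  assumes ip: "is_inner_product ip" and "f differentiable (at x)"
  shows "(f has_derivative (\<lambda>v. ip (gradient ip f x) v)) (at x)"
proof -
  from assms(2) obtain D where D: "(f has_derivative D) (at x)"
    by (auto simp: differentiable_def)
  have lin: "linear (\<lambda>v. ip g v)" "linear (\<lambda>g. ip g v)" for g v
    using ip unfolding is_inner_product_def bilinear_def by auto
  define R where "R l = (\<Sum>b\<in>Basis. l b *\<^sub>R b)" for l :: "real ^ 'n \<Rightarrow> real"
  have repr: "l v = R l \<bullet> v" if "linear l" for l v
  proof -
    have "l v = l (\<Sum>b\<in>Basis. (v \<bullet> b) *\<^sub>R b)"
      by (simp only: euclidean_representation)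
    also have "\<dots> = (\<Sum>b\<in>Basis. (v \<bullet> b) * l b)"
      by (simp only: linear_sum[OF that] linear_scale[OF that] real_scaleR_def)
    also have "\<dots> = R l \<bullet> v"
      by (simp only: R_def inner_sum_left inner_scaleR_left inner_commute[of v] mult.commute)
    finally show ?thesis .
  qed
  define A where "A g = R (\<lambda>v. ip g v)" for g
  have A: "ip g v = A g \<bullet> v" for g v
    unfolding A_def by (rule repr[OF lin(1)])
  have "linear A"
  proof (rule linearI)
    show "A (g + g') = A g + A g'" for g g'
      by (simp only: A_def R_def linear_add[OF lin(2)] scaleR_add_left sum.distrib)
    show "A (r *\<^sub>R g) = r *\<^sub>R A g" for r g
      by (simp only: A_def R_def linear_scale[OF lin(2)] scaleR_sum_right scaleR_scaleR
          real_scaleR_def)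
  qed
  moreover have "inj A"
    unfolding linear_injective_0[OF \<open>linear A\<close>]
  proof (intro allI impI)
    fix g assume "A g = 0"
    then have "\<not> 0 < ip g g" by (simp add: A)
    then show "g = 0" using ip unfolding is_inner_product_def by blast
  qed
  ultimately have "surj A" by (rule linear_inj_imp_surj)
  then obtain g where g: "A g = R D" by (auto simp: surj_def dest!: spec[of _ "R D"])
  have "D = (\<lambda>v. ip g v)"
  proof
    show "D v = ip g v" for v
      by (simp only: repr[OF has_derivative_linear[OF D], of v] A g)
  qed
  then have "(f has_derivative (\<lambda>v. ip g v)) (at x)" using D by simp
  then show ?thesis using gradient_eqI[OF ip] by simp
qed

definition L_smooth ::
  "(real ^ 'n \<Rightarrow> real ^ 'n \<Rightarrow> real) \<Rightarrow> real \<Rightarrow> (real ^ 'n \<Rightarrow> real) \<Rightarrow> bool" where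
  "L_smooth ip L f \<longleftrightarrow>
     (\<forall>x. f differentiable (at x)) \<and>
     (\<forall>x y. ip_norm ip (gradient ip f x - gradient ip f y) \<le> L * ip_norm ip (x - y))"

definition strongly_convex ::
  "(real ^ 'n \<Rightarrow> real ^ 'n \<Rightarrow> real) \<Rightarrow> real \<Rightarrow> (real ^ 'n \<Rightarrow> real) \<Rightarrow> bool" where
  "strongly_convex ip \<mu> f \<longleftrightarrow>
     (\<forall>x. f differentiable (at x)) \<and>
     (\<forall>x y. f x \<ge> f y + ip (gradient ip f y) (x - y) + \<mu> / 2 * (ip_norm ip (x - y))\<^sup>2)"

end

theory Submission
  imports Defs
begin

text \<open>
  The inexact direction \<open>d\<close> is an exact gradient for another inner product. The angle and
  length conditions on \<open>d\<close> say that \<open>\<langle>g - m d, M d - g\<rangle> = 0\<close> for \<open>g = \<nabla>f x\<close>,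
  \<open>m = cos \<theta> / (c (1 + sin \<theta>))\<close> and \<open>M = cos \<theta> / (c (1 - sin \<theta>))\<close>. Nonnegativity of that
  product is what makes a self-adjoint operator \<open>Q\<close> with \<open>Q d = g\<close> and spectrum in \<open>[m, M]\<close>
  available (\<open>ex_inner_product_mapping\<close>). In the inner product \<open>q v w = \<langle>Q v, w\<rangle>\<close> the
  gradient of \<open>f\<close> at \<open>x\<close> is \<open>d\<close>. The lower and upper quadratic models of \<open>f\<close> survive the
  change of inner product, with \<open>\<mu>\<close> replaced by \<open>\<mu> / M\<close> and \<open>L\<close> by \<open>L / m\<close>. The
  step from \<open>x\<close> is then an ordinary gradient step, \<open>hbar\<close> is \<open>2 / (L / m + \<mu> / M)\<close>, and
  \<open>\<kappa>\<close> is the condition number in the new inner product.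

  What remains is the rate \<open>(1 - h \<mu>)\<^sup>2\<close> for an exact gradient step with
  \<open>h \<le> 2 / (L + \<mu>)\<close> (\<open>gradient_step_contraction\<close>). Three instances of the cocoercivity
  inequality \<open>bregman_gap_cocoercive\<close>, between \<open>x\<close>, the new point and the minimizer, are
  added with weights \<open>\<rho>\<close>, \<open>\<rho> (1 - \<rho>)\<close> and \<open>1 - \<rho>\<close> for \<open>\<rho> = 1 - h \<mu>\<close>. The function
  values combine to \<open>\<rho>\<^sup>2 (f x - f xstar) - (f x1 - f xstar)\<close>, and the remaining quadratic
  form in the gradients is a sum of two nonnegative terms.
\<close>

section \<open>Inner products and their norms\<close>

lemma inner_product_simps:
  assumes "is_inner_product ip"
  shows "ip (x + y) z = ip x z + ip y z" "ip z (x + y) = ip z x + ip z y"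
    "ip (x - y) z = ip x z - ip y z" "ip z (x - y) = ip z x - ip z y"
    "ip (r *\<^sub>R x) z = r * ip x z" "ip z (r *\<^sub>R x) = r * ip z x"
    "ip (- x) z = - ip x z" "ip z (- x) = - ip z x"
    "ip 0 z = 0" "ip z 0 = 0"
  using assms unfolding is_inner_product_def
  by (simp_all add: bilinear_ladd bilinear_radd bilinear_lsub bilinear_rsub bilinear_lmul
      bilinear_rmul bilinear_lneg bilinear_rneg bilinear_lzero bilinear_rzero)

lemma inner_product_commute: "is_inner_product ip \<Longrightarrow> ip x y = ip y x"
  unfolding is_inner_product_def by blast

lemma inner_product_nonneg: "is_inner_product ip \<Longrightarrow> 0 \<le> ip x x"
  by (cases "x = 0") (auto simp: inner_product_simps is_inner_product_def less_imp_le)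

lemma inner_product_eq_zero: "is_inner_product ip \<Longrightarrow> ip x x = 0 \<longleftrightarrow> x = 0"
  by (metis inner_product_simps(9) is_inner_product_def less_irrefl)

lemma ip_norm_nonneg: "is_inner_product ip \<Longrightarrow> 0 \<le> ip_norm ip x"
  by (simp add: ip_norm_def inner_product_nonneg)

lemma ip_norm_power2: "is_inner_product ip \<Longrightarrow> (ip_norm ip x)\<^sup>2 = ip x x"
  by (simp add: ip_norm_def inner_product_nonneg)

lemma inner_product_Cauchy_Schwarz:
  assumes ip: "is_inner_product ip"
  shows "(ip u v)\<^sup>2 \<le> ip u u * ip v v"
proof (cases "v = 0")
  case False
  then have pos: "0 < ip v v" using ip unfolding is_inner_product_def by blast
  have "0 \<le> ip (ip v v *\<^sub>R u - ip u v *\<^sub>R v) (ip v v *\<^sub>R u - ip u v *\<^sub>R v)"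
    by (rule inner_product_nonneg[OF ip])
  also have "\<dots> = ip v v * (ip u u * ip v v - (ip u v)\<^sup>2)"
    by (simp add: inner_product_simps[OF ip] inner_product_commute[OF ip, of v u]
        power2_eq_square algebra_simps)
  finally show ?thesis using pos by (simp add: zero_le_mult_iff)
qed (simp add: inner_product_simps[OF ip])

lemma inner_product_le_norms:
  assumes ip: "is_inner_product ip"
  shows "ip u v \<le> ip_norm ip u * ip_norm ip v"
proof (rule power2_le_imp_le)
  show "(ip u v)\<^sup>2 \<le> (ip_norm ip u * ip_norm ip v)\<^sup>2"
    using inner_product_Cauchy_Schwarz[OF ip, of u v]
    by (simp add: power_mult_distrib ip_norm_power2[OF ip])
qed (simp add: ip_norm_nonneg[OF ip])

section \<open>Quadratic models of a smooth strongly convex function\<close>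

text \<open>
  Unlike Lipschitz continuity of the gradient, this consequence of it passes to a comparable
  inner product just by comparing the quadratic terms: the linear term, the differential of
  \<open>f\<close>, does not depend on the inner product.
\<close>

definition quadratic_upper_bound ::
  "(real ^ 'n \<Rightarrow> real ^ 'n \<Rightarrow> real) \<Rightarrow> real \<Rightarrow> (real ^ 'n \<Rightarrow> real) \<Rightarrow> bool" where
  "quadratic_upper_bound ip L f \<longleftrightarrow>
     (\<forall>x y. f x \<le> f y + ip (gradient ip f y) (x - y) + L / 2 * ip (x - y) (x - y))"

text \<open>
  On the segment from \<open>y\<close> to \<open>x\<close>, subtracting the model from \<open>f\<close> leaves a function whose
  derivative is nonpositive, by Cauchy-Schwarz and the Lipschitz bound.
\<close>

lemma L_smooth_imp_quadratic_upper_bound: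
  fixes f :: "real ^ 'n \<Rightarrow> real"
  assumes ip: "is_inner_product ip" and smooth: "L_smooth ip L f"
  shows "quadratic_upper_bound ip L f"
  unfolding quadratic_upper_bound_def
proof (intro allI)
  fix x y :: "real ^ 'n"
  let ?g = "gradient ip f"
  define v where "v = x - y"
  define \<phi> where "\<phi> t = f (y + t *\<^sub>R v) - t * ip (?g y) v - L / 2 * t\<^sup>2 * ip v v" for t :: real
  have "\<phi> 1 \<le> \<phi> 0"
  proof (rule DERIV_nonpos_imp_nonincreasing, simp)
    fix t :: real assume t: "0 \<le> t" "t \<le> 1"
    let ?y = "y + t *\<^sub>R v"
    have "(f has_derivative (\<lambda>w. ip (?g ?y) w)) (at ?y)"
      using smooth unfolding L_smooth_def by (intro has_derivative_gradient[OF ip]) blast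
    moreover have "((\<lambda>t. y + t *\<^sub>R v) has_derivative (\<lambda>s. s *\<^sub>R v)) (at t)"
      by (auto intro!: derivative_eq_intros)
    ultimately have "((\<lambda>t. f (y + t *\<^sub>R v)) has_derivative (\<lambda>s. ip (?g ?y) (s *\<^sub>R v))) (at t)"
      by (rule has_derivative_compose[rotated])
    then have "((\<lambda>t. f (y + t *\<^sub>R v)) has_real_derivative ip (?g ?y) v) (at t)"
      by (simp add: has_field_derivative_def inner_product_simps[OF ip] mult_commute_abs)
    then have "(\<phi> has_real_derivative ip (?g ?y) v - ip (?g y) v - L * t * ip v v) (at t)"
      unfolding \<phi>_def[abs_def] by (auto intro!: derivative_eq_intros)
    moreover have "ip (?g ?y) v - ip (?g y) v \<le> L * t * ip v v"
    proof -
      have "ip (?g ?y) v - ip (?g y) v = ip (?g ?y - ?g y) v"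
        by (simp add: inner_product_simps[OF ip])
      also have "\<dots> \<le> ip_norm ip (?g ?y - ?g y) * ip_norm ip v"
        by (rule inner_product_le_norms[OF ip])
      also have "\<dots> \<le> (L * ip_norm ip (?y - y)) * ip_norm ip v"
        using smooth unfolding L_smooth_def
        by (intro mult_right_mono ip_norm_nonneg[OF ip]) blast
      also have "ip_norm ip (?y - y) = t * ip_norm ip v"
        using t by (simp add: ip_norm_def inner_product_simps[OF ip] real_sqrt_mult)
      also have "L * (t * ip_norm ip v) * ip_norm ip v = L * t * (ip_norm ip v)\<^sup>2"
        by (simp add: power2_eq_square)
      finally show ?thesis by (simp add: ip_norm_power2[OF ip])
    qed
    ultimately show "\<exists>z. (\<phi> has_real_derivative z) (at t) \<and> z \<le> 0"
      by (intro exI conjI) (assumption, simp)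
  qed
  then show "f x \<le> f y + ip (?g y) (x - y) + L / 2 * ip (x - y) (x - y)"
    by (simp add: \<phi>_def v_def)
qed

text \<open>
  This is the Bregman divergence of the convex function \<open>f - (\<mu> / 2) \<parallel>\<cdot>\<parallel>\<^sup>2\<close>.
\<close>

definition bregman_gap ::
  "(real ^ 'n \<Rightarrow> real ^ 'n \<Rightarrow> real) \<Rightarrow> real \<Rightarrow> (real ^ 'n \<Rightarrow> real) \<Rightarrow> real ^ 'n \<Rightarrow> real ^ 'n \<Rightarrow> real"
  where "bregman_gap ip \<mu> f x y =
    f x - f y - ip (gradient ip f y) (x - y) - \<mu> / 2 * ip (x - y) (x - y)"

lemma bregman_gap_nonneg:
  assumes "is_inner_product ip" and "strongly_convex ip \<mu> f"
  shows "0 \<le> bregman_gap ip \<mu> f x y"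
proof -
  have "f x \<ge> f y + ip (gradient ip f y) (x - y) + \<mu> / 2 * (ip_norm ip (x - y))\<^sup>2"
    using assms(2) unfolding strongly_convex_def by blast
  then show ?thesis by (simp add: bregman_gap_def ip_norm_power2[OF assms(1)])
qed

text \<open>
  As a function of its first argument the gap is nonnegative, has gradient \<open>w x y\<close> at \<open>x\<close>,
  and lies below its quadratic model of curvature \<open>L - \<mu>\<close> there. A step of length \<open>t\<close> along
  the negative gradient cannot make it negative, and the best \<open>t\<close> is \<open>1 / (L - \<mu>)\<close>. The
  bound is kept free of division so that for \<open>L = \<mu>\<close> it states that \<open>w x y\<close> vanishes.
\<close>

lemma bregman_gap_cocoercive:
  assumes ip: "is_inner_product ip" and sc: "strongly_convex ip \<mu> f"
    and ub: "quadratic_upper_bound ip L f" and "\<mu> \<le> L"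
  defines "w \<equiv> \<lambda>x y. gradient ip f x - gradient ip f y - \<mu> *\<^sub>R (x - y)"
  shows "ip (w x y) (w x y) \<le> 2 * (L - \<mu>) * bregman_gap ip \<mu> f x y"
proof -
  let ?W = "ip (w x y) (w x y)"
  let ?E = "bregman_gap ip \<mu> f x y"
  have step: "t * ?W - (L - \<mu>) / 2 * t\<^sup>2 * ?W \<le> ?E" for t
  proof -
    define z where "z = x - t *\<^sub>R w x y"
    have "f z \<le> f x + ip (gradient ip f x) (z - x) + L / 2 * ip (z - x) (z - x)"
      using ub unfolding quadratic_upper_bound_def by blast
    moreover have "bregman_gap ip \<mu> f z y = ?E - t * ?W - \<mu> / 2 * t\<^sup>2 * ?W
        + (f z - f x - ip (gradient ip f x) (z - x))"
      unfolding bregman_gap_def z_def w_def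
      by (simp add: inner_product_simps[OF ip] inner_product_commute[OF ip] power2_eq_square
          field_simps)
    moreover have "ip (z - x) (z - x) = t\<^sup>2 * ?W"
      by (simp add: z_def inner_product_simps[OF ip] power2_eq_square)
    ultimately show ?thesis
      using bregman_gap_nonneg[OF ip sc, of z y] by (simp add: algebra_simps diff_divide_distrib)
  qed
  show ?thesis
  proof (cases "\<mu> = L")
    case False
    define D where "D = L - \<mu>"
    have D: "0 < D" using False \<open>\<mu> \<le> L\<close> by (simp add: D_def)
    have "?W = 2 * D * (1 / D * ?W - D / 2 * (1 / D)\<^sup>2 * ?W)"
      using D by (simp add: power2_eq_square)
    also have "\<dots> \<le> 2 * D * ?E"
      using step[of "1 / D"] D by (intro mult_left_mono) (simp_all add: D_def)
    finally show ?thesis by (simp add: D_def)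
  next
    case True
    have "\<not> 0 < ?W"
    proof
      assume "0 < ?W"
      \<comment> \<open>Without curvature the gap decreases linearly in \<open>t\<close>, so a long step makes it negative.\<close>
      with step[of "(?E + 1) / ?W"] show False by (simp add: True)
    qed
    then show ?thesis by (simp add: True)
  qed
qed

lemma gradient_at_minimizer:
  assumes ip: "is_inner_product ip" and ub: "quadratic_upper_bound ip L f" and "0 < L"
    and min: "is_arg_min f (\<lambda>_. True) xstar"
  shows "gradient ip f xstar = 0"
proof -
  let ?g = "gradient ip f xstar"
  let ?z = "xstar - (1 / L) *\<^sub>R ?g"
  have "f xstar \<le> f ?z" using min by (simp add: is_arg_min_linorder)
  also have "\<dots> \<le> f xstar + ip ?g (?z - xstar) + L / 2 * ip (?z - xstar) (?z - xstar)"
    using ub unfolding quadratic_upper_bound_def by blast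
  also have "\<dots> = f xstar - ip ?g ?g / (2 * L)"
    using \<open>0 < L\<close> by (simp add: inner_product_simps[OF ip] field_simps)
  finally have "ip ?g ?g \<le> 0" using \<open>0 < L\<close> by (simp add: divide_le_0_iff)
  then show ?thesis
    using inner_product_nonneg[OF ip, of ?g] inner_product_eq_zero[OF ip, of ?g] by simp
qed

section \<open>One exact gradient step\<close>

text \<open>
  The bound \<open>h \<le> 2 / (L + \<mu>)\<close> enters at two places: it makes the weight \<open>1 - h \<mu>\<close>
  nonnegative, and it is equivalent (for \<open>h > 0\<close>) to semidefiniteness of the quadratic form
  \<open>\<parallel>P\<parallel>\<^sup>2 - 2 (1 - L h) \<langle>P, p\<rangle> + (1 - L \<mu> h\<^sup>2) \<parallel>p\<parallel>\<^sup>2\<close> left over by the weighted sum. Here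
  \<open>p\<close> and \<open>P\<close> are the gradients of \<open>f - (\<mu> / 2) \<parallel>\<cdot> - xstar\<parallel>\<^sup>2\<close> at the old and the new
  point; in these variables the position \<open>x - xstar\<close> cancels.
\<close>

lemma gradient_step_contraction:
  assumes ip: "is_inner_product ip" and sc: "strongly_convex ip \<mu> f"
    and ub: "quadratic_upper_bound ip L f" and \<mu>: "0 < \<mu>" "\<mu> \<le> L"
    and min: "is_arg_min f (\<lambda>_. True) xstar"
    and h: "0 \<le> h" "h \<le> 2 / (L + \<mu>)"
  shows "f (x - h *\<^sub>R gradient ip f x) - f xstar \<le> (1 - h * \<mu>)\<^sup>2 * (f x - f xstar)"
proof -
  define \<rho> where "\<rho> = 1 - h * \<mu>"
  define g where "g = gradient ip f x"
  define x1 where "x1 = x - h *\<^sub>R g"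
  define G where "G = gradient ip f x1"
  define y where "y = x - xstar"
  define p where "p = g - \<mu> *\<^sub>R y"
  define P where "P = G - \<mu> *\<^sub>R (y - h *\<^sub>R g)"
  define r where "r = P - (1 - L * h) *\<^sub>R p"
  let ?E = "bregman_gap ip \<mu> f"
  note S = inner_product_simps[OF ip] inner_product_commute[OF ip]
  have h2: "h * (L + \<mu>) \<le> 2" using h \<mu> by (simp add: field_simps)
  have "h * \<mu> \<le> h * ((L + \<mu>) / 2)" using h \<mu> by (intro mult_left_mono) auto
  with h2 have \<rho>: "0 \<le> \<rho>" by (simp add: \<rho>_def)
  have h\<mu>: "0 \<le> h * \<mu>" using h \<mu> by simp
  have g0: "gradient ip f xstar = 0" using gradient_at_minimizer[OF ip ub _ min] \<mu> by simp
  have E: "0 \<le> ?E a b" for a b by (rule bregman_gap_nonneg[OF ip sc])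
  have C01: "ip (p - P) (p - P) \<le> 2 * (L - \<mu>) * ?E x x1"
    using bregman_gap_cocoercive[OF ip sc ub \<mu>(2), of x x1]
    by (simp add: p_def P_def G_def g_def x1_def y_def algebra_simps)
  have C0: "ip p p \<le> 2 * (L - \<mu>) * ?E xstar x"
    using bregman_gap_cocoercive[OF ip sc ub \<mu>(2), of xstar x]
    by (simp add: p_def g_def y_def g0 S algebra_simps)
  have C1: "ip P P \<le> 2 * (L - \<mu>) * ?E xstar x1"
    using bregman_gap_cocoercive[OF ip sc ub \<mu>(2), of xstar x1]
    by (simp add: P_def G_def g_def x1_def y_def g0 S algebra_simps)
  have E01: "?E x x1 = f x - f x1 - h * ip G g - \<mu> / 2 * h\<^sup>2 * ip g g"
    by (simp add: bregman_gap_def G_def x1_def S power2_eq_square)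
  have E0: "?E xstar x = f xstar - f x + ip g y - \<mu> / 2 * ip y y"
    by (simp add: bregman_gap_def g_def y_def S algebra_simps)
  have E1: "?E xstar x1 = f xstar - f x1 + ip G (y - h *\<^sub>R g)
      - \<mu> / 2 * ip (y - h *\<^sub>R g) (y - h *\<^sub>R g)"
    unfolding bregman_gap_def G_def[symmetric]
    by (simp add: x1_def y_def S algebra_simps)
  \<comment> \<open>An identity: the weights are chosen so that all multiples of \<open>f x\<close>, \<open>f x1\<close> and
    \<open>f xstar\<close> outside the gaps match.\<close>
  have key: "\<rho>\<^sup>2 * (f x - f xstar) - (f x1 - f xstar) =
      (\<rho> * ?E x x1 + \<rho> * (h * \<mu>) * ?E xstar x + h * \<mu> * ?E xstar x1)
      + h * ip P p - \<mu> * h\<^sup>2 / 2 * ip p p"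
    unfolding E01 E0 E1 p_def P_def \<rho>_def
    by (simp add: S power2_eq_square field_simps)
  have "0 \<le> \<rho>\<^sup>2 * (f x - f xstar) - (f x1 - f xstar)"
  \<comment> \<open>Dividing by \<open>L - \<mu>\<close> is impossible if \<open>\<mu> = L\<close>; then \<open>f\<close> is a quadratic and \<open>p\<close> vanishes.\<close>
  proof (cases "\<mu> = L")
    case True
    then have "ip p p \<le> 0" using C0 by simp
    then have "p = 0"
      using inner_product_nonneg[OF ip, of p] inner_product_eq_zero[OF ip, of p] by simp
    then show ?thesis unfolding key using E \<rho> h\<mu> by (simp add: S)
  next
    case False
    \<comment> \<open>Completing the square in \<open>P\<close> leaves \<open>(1 - L \<mu> h\<^sup>2) - (1 - L h)\<^sup>2\<close> as the coefficient of
      \<open>ip p p\<close>.\<close>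
    have "0 \<le> ip r r + L * h * (2 - h * (L + \<mu>)) * ip p p"
      using inner_product_nonneg[OF ip] h h2 \<mu> by (intro add_nonneg_nonneg mult_nonneg_nonneg) auto
    also have "\<dots> = \<rho> * ip (p - P) (p - P) + \<rho> * (h * \<mu>) * ip p p + h * \<mu> * ip P P
        + 2 * (L - \<mu>) * (h * ip P p - \<mu> * h\<^sup>2 / 2 * ip p p)"
      unfolding r_def \<rho>_def by (simp add: S power2_eq_square field_simps)
    also have "\<dots> \<le> \<rho> * (2 * (L - \<mu>) * ?E x x1) + \<rho> * (h * \<mu>) * (2 * (L - \<mu>) * ?E xstar x)
        + h * \<mu> * (2 * (L - \<mu>) * ?E xstar x1)
        + 2 * (L - \<mu>) * (h * ip P p - \<mu> * h\<^sup>2 / 2 * ip p p)"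
      using \<rho> h\<mu> \<mu> by (intro add_mono mult_left_mono C01 C0 C1) auto
    also have "\<dots> = 2 * (L - \<mu>) * (\<rho>\<^sup>2 * (f x - f xstar) - (f x1 - f xstar))"
      unfolding key by (simp only: algebra_simps)
    finally show ?thesis using False \<mu> by (simp add: zero_le_mult_iff)
  qed
  then show ?thesis by (simp add: \<rho>_def x1_def g_def)
qed

section \<open>Changing the inner product\<close>

text \<open>
  The operator behind \<open>q\<close> is \<open>m\<close> times the identity plus a multiple of the projection onto the
  line through \<open>u = g - m d\<close>, the self-adjoint correction of rank one that sends \<open>d\<close> to
  \<open>g\<close>. Its eigenvalues are among \<open>m\<close> and \<open>m + \<langle>u, u\<rangle> / \<langle>u, d\<rangle>\<close>, and the hypothesis on \<open>g\<close> and \<open>d\<close> is precisely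
  \<open>\<langle>u, u\<rangle> \<le> (M - m) \<langle>u, d\<rangle>\<close>, which bounds the second one by \<open>M\<close>.
\<close>

lemma ex_inner_product_mapping:
  assumes ip: "is_inner_product ip" and m: "0 < m" "m \<le> M"
    and gd: "0 \<le> ip (g - m *\<^sub>R d) (M *\<^sub>R d - g)"
  obtains q where "is_inner_product q" "\<And>v. q d v = ip g v"
    "\<And>v. m * ip v v \<le> q v v" "\<And>v. q v v \<le> M * ip v v"
proof -
  define u where "u = g - m *\<^sub>R d"
  \<comment> \<open>If \<open>ip u d = 0\<close> then \<open>u = 0\<close>, and \<open>0 / 0 = 0\<close> gives the correct value \<open>m * ip v w\<close>.\<close>
  define q where "q v w = m * ip v w + ip u v * ip u w / ip u d" for v w
  note S = inner_product_simps[OF ip]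
  have "M *\<^sub>R d - g = (M - m) *\<^sub>R d - u" by (simp add: u_def algebra_simps)
  with gd have uu: "ip u u \<le> (M - m) * ip u d" by (simp add: u_def[symmetric] S)
  have ud: "0 \<le> ip u d"
  proof (rule ccontr)
    assume neg: "\<not> 0 \<le> ip u d"
    then have "(M - m) * ip u d \<le> 0" using m by (intro mult_nonneg_nonpos) auto
    with uu have "ip u u = 0" using inner_product_nonneg[OF ip, of u] by linarith
    then have "u = 0" by (simp only: inner_product_eq_zero[OF ip])
    with neg show False by (simp add: S)
  qed
  have u0: "u = 0" if "ip u d = 0"
    using that uu inner_product_nonneg[OF ip, of u] by (simp add: inner_product_eq_zero[OF ip])
  have low: "m * ip v v \<le> q v v" for v using ud by (simp add: q_def)
  have "is_inner_product q"
    unfolding is_inner_product_def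
  proof (intro conjI allI impI)
    show "bilinear q" unfolding bilinear_def q_def
      by (intro conjI allI linearI) (simp_all add: S algebra_simps add_divide_distrib)
    show "q v w = q w v" for v w by (simp add: q_def inner_product_commute[OF ip, of v w])
    show "0 < q v v" if "v \<noteq> 0" for v
      using that m ip low[of v] unfolding is_inner_product_def
      by (blast intro: less_le_trans mult_pos_pos)
  qed
  moreover have "q d v = ip g v" for v
  proof -
    have "q d v = m * ip d v + ip u v" using u0 by (cases "ip u d = 0") (auto simp: q_def S)
    then show ?thesis by (simp add: u_def S)
  qed
  moreover have "q v v \<le> M * ip v v" for v
  proof -
    have "ip u v * ip u v \<le> ip u u * ip v v"
      using inner_product_Cauchy_Schwarz[OF ip, of u v] by (simp add: power2_eq_square)
    also have "\<dots> \<le> (M - m) * ip u d * ip v v"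
      by (rule mult_right_mono[OF uu inner_product_nonneg[OF ip]])
    finally have "ip u v * ip u v / ip u d \<le> (M - m) * ip v v"
      using ud m inner_product_nonneg[OF ip, of v]
      by (cases "ip u d = 0") (auto simp: field_simps intro: mult_right_mono)
    then show ?thesis by (simp add: q_def algebra_simps)
  qed
  ultimately show ?thesis using that low by blast
qed

lemma gradient_change_inner_product:
  assumes "is_inner_product ip" "is_inner_product q" "f differentiable (at x)"
  shows "q (gradient q f x) v = ip (gradient ip f x) v"
  using has_derivative_unique[OF has_derivative_gradient[OF assms(2,3)]
      has_derivative_gradient[OF assms(1,3)]]
  by (rule fun_cong)

lemma strongly_convex_change_inner_product:
  fixes f :: "real ^ 'n \<Rightarrow> real"
  assumes ip: "is_inner_product ip" and q: "is_inner_product q" and sc: "strongly_convex ip \<mu> f"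
    and le: "\<And>v. q v v \<le> M * ip v v" and "0 < M" "0 \<le> \<mu>"
  shows "strongly_convex q (\<mu> / M) f"
  unfolding strongly_convex_def
proof (intro conjI allI)
  show diff: "f differentiable (at x)" for x using sc unfolding strongly_convex_def by blast
  fix x y :: "real ^ 'n"
  have "f x \<ge> f y + ip (gradient ip f y) (x - y) + \<mu> / 2 * (ip_norm ip (x - y))\<^sup>2"
    using sc unfolding strongly_convex_def by blast
  moreover have "\<mu> / M / 2 * q (x - y) (x - y) \<le> \<mu> / M / 2 * (M * ip (x - y) (x - y))"
    using le \<open>0 < M\<close> \<open>0 \<le> \<mu>\<close> by (intro mult_left_mono) auto
  ultimately show "f x \<ge> f y + q (gradient q f y) (x - y) + \<mu> / M / 2 * (ip_norm q (x - y))\<^sup>2"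
    using \<open>0 < M\<close>
    by (simp add: ip_norm_power2[OF ip] ip_norm_power2[OF q]
        gradient_change_inner_product[OF ip q diff])
qed

lemma quadratic_upper_bound_change_inner_product:
  fixes f :: "real ^ 'n \<Rightarrow> real"
  assumes ip: "is_inner_product ip" and q: "is_inner_product q"
    and diff: "\<And>x. f differentiable (at x)" and ub: "quadratic_upper_bound ip L f"
    and le: "\<And>v. m * ip v v \<le> q v v" and "0 < m" "0 \<le> L"
  shows "quadratic_upper_bound q (L / m) f"
  unfolding quadratic_upper_bound_def
proof (intro allI)
  fix x y :: "real ^ 'n"
  have "f x \<le> f y + ip (gradient ip f y) (x - y) + L / 2 * ip (x - y) (x - y)"
    using ub unfolding quadratic_upper_bound_def by blast
  moreover have "L / m / 2 * (m * ip (x - y) (x - y)) \<le> L / m / 2 * q (x - y) (x - y)"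
    using le \<open>0 < m\<close> \<open>0 \<le> L\<close> by (intro mult_left_mono) auto
  ultimately show "f x \<le> f y + q (gradient q f y) (x - y) + L / m / 2 * q (x - y) (x - y)"
    using \<open>0 < m\<close> by (simp add: gradient_change_inner_product[OF ip q diff])
qed

section \<open>One step along an inexact gradient\<close>

text \<open>
  The hypothesis relating \<open>d\<close> to the gradient means that \<open>d\<close> is the image of the gradient under
  some self-adjoint operator with spectrum in \<open>[1 / M, 1 / m]\<close>. Such an operator is a
  preconditioner, and the rate is that of the preconditioned problem.
\<close>

lemma relative_direction_contraction:
  assumes ip: "is_inner_product ip" and smooth: "L_smooth ip L f"
    and sc: "strongly_convex ip \<mu> f" and \<mu>: "0 < \<mu>" "\<mu> \<le> L"
    and min: "is_arg_min f (\<lambda>_. True) xstar" and m: "0 < m" "m \<le> M"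
    and gd: "0 \<le> ip (gradient ip f x - m *\<^sub>R d) (M *\<^sub>R d - gradient ip f x)"
    and h: "0 \<le> h" "h \<le> 2 / (L / m + \<mu> / M)"
  shows "f (x - h *\<^sub>R d) - f xstar \<le> (1 - h * (\<mu> / M))\<^sup>2 * (f x - f xstar)"
proof -
  obtain q where q: "is_inner_product q" and qd: "\<And>v. q d v = ip (gradient ip f x) v"
    and low: "\<And>v. m * ip v v \<le> q v v" and up: "\<And>v. q v v \<le> M * ip v v"
    using ex_inner_product_mapping[OF ip m gd] by blast
  have diff: "f differentiable (at y)" for y using sc unfolding strongly_convex_def by blast
  have "(f has_derivative q d) (at x)"
    using has_derivative_gradient[OF ip diff, of x] by (simp add: qd[abs_def, symmetric])
  then have grad: "gradient q f x = d" by (rule gradient_eqI[OF q])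
  have scq: "strongly_convex q (\<mu> / M) f"
    using strongly_convex_change_inner_product[OF ip q sc up] m \<mu> by simp
  have ubq: "quadratic_upper_bound q (L / m) f"
    using quadratic_upper_bound_change_inner_product[OF ip q diff
        L_smooth_imp_quadratic_upper_bound[OF ip smooth] low] m \<mu> by simp
  have "\<mu> / M \<le> L / m" using m \<mu> by (intro frac_le) auto
  then show ?thesis
    using gradient_step_contraction[OF q scq ubq _ _ min h, of x] m \<mu> by (simp add: grad)
qed

theorem theorem3p2:
  fixes ip :: "real ^ 'n \<Rightarrow> real ^ 'n \<Rightarrow> real"
    and f :: "real ^ 'n \<Rightarrow> real"
    and x d xstar :: "real ^ 'n"
    and L \<mu> \<theta> c hbar \<kappa> :: real
  assumes "is_inner_product ip"
    and "L_smooth ip L f"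
    and "strongly_convex ip \<mu> f"
    and "0 < \<mu>" and "\<mu> \<le> L"
    and "is_arg_min f (\<lambda>_. True) xstar"
    and "0 \<le> \<theta>" and "\<theta> < pi / 2" and "c > 0"
    and "ip (gradient ip f x) d = cos \<theta> * ip_norm ip (gradient ip f x) * ip_norm ip d"
    and "ip_norm ip d = c * ip_norm ip (gradient ip f x)"
    and hbar: "hbar = 2 * cos \<theta> / (L * c * (1 + sin \<theta>) + \<mu> * c * (1 - sin \<theta>))"
    and kappa: "\<kappa> = L / \<mu> * ((1 + sin \<theta>) / (1 - sin \<theta>))"
  shows "(\<forall>h. 0 \<le> h \<and> h \<le> hbar \<longrightarrow>
            f (x - h *\<^sub>R d) - f xstar
              \<le> (1 - h * \<mu> * c * (1 - sin \<theta>) / cos \<theta>)\<^sup>2 * (f x - f xstar))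
         \<and> f (x - hbar *\<^sub>R d) - f xstar \<le> ((\<kappa> - 1) / (\<kappa> + 1))\<^sup>2 * (f x - f xstar)"
proof -
  note ip = assms(1)
  define s where "s = sin \<theta>"
  define C where "C = cos \<theta>"
  define m where "m = C / (c * (1 + s))"
  define M where "M = C / (c * (1 - s))"
  have C: "0 < C" unfolding C_def using assms(7,8) by (intro cos_gt_zero_pi) auto
  have s0: "0 \<le> s" unfolding s_def using assms(7,8) by (intro sin_ge_zero) auto
  have sC: "C\<^sup>2 = (1 + s) * (1 - s)"
    by (simp add: C_def s_def cos_squared_eq power2_eq_square algebra_simps)
  have "0 < C\<^sup>2" using C by simp
  then have s1: "s < 1" unfolding sC using s0 by (simp add: zero_less_mult_iff)
  note pos = C s0 s1 \<open>c > 0\<close>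
  have m: "0 < m" using pos by (simp add: m_def)
  have mM: "m \<le> M" unfolding m_def M_def using pos by (intro frac_le mult_left_mono) auto
  have "m * (C * c) = C\<^sup>2 / (1 + s)" and "M * (C * c) = C\<^sup>2 / (1 - s)"
    using pos by (simp_all add: m_def M_def power2_eq_square)
  moreover have "C\<^sup>2 / (1 + s) = 1 - s" and "C\<^sup>2 / (1 - s) = 1 + s"
    unfolding sC using pos by simp_all
  ultimately have sum: "(m + M) * (C * c) = 2" by (simp add: distrib_right)
  have "m * M * c\<^sup>2 = C\<^sup>2 / ((1 + s) * (1 - s))"
    using pos by (simp add: m_def M_def power2_eq_square)
  then have prod: "m * M * c\<^sup>2 = 1"
    unfolding sC using pos by simp
  let ?g = "gradient ip f x"
  have gdot: "ip ?g d = C * c * ip ?g ?g"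
    using assms(10) by (simp add: assms(11) C_def ip_norm_power2[OF ip, symmetric] power2_eq_square)
  have dd: "ip d d = c\<^sup>2 * ip ?g ?g"
    by (simp add: ip_norm_power2[OF ip, symmetric] assms(11) power_mult_distrib)
  \<comment> \<open>With both hypotheses on \<open>d\<close> inserted the product is \<open>2 - 1 - 1\<close> times \<open>ip ?g ?g\<close>.\<close>
  have "ip (?g - m *\<^sub>R d) (M *\<^sub>R d - ?g)
      = (m + M) * ip ?g d - ip ?g ?g - m * M * ip d d"
    by (simp add: inner_product_simps[OF ip] inner_product_commute[OF ip, of d ?g] algebra_simps)
  also have "\<dots> = ((m + M) * (C * c) - 1 - m * M * c\<^sup>2) * ip ?g ?g"
    unfolding gdot dd by (simp add: algebra_simps)
  also have "\<dots> = 0" unfolding sum prod by simp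
  finally have gd: "0 \<le> ip (?g - m *\<^sub>R d) (M *\<^sub>R d - ?g)" by simp
  have Lm: "L / m + \<mu> / M = (L * c * (1 + s) + \<mu> * c * (1 - s)) / C"
    by (simp add: m_def M_def add_divide_distrib)
  have hb: "hbar = 2 / (L / m + \<mu> / M)"
    unfolding Lm by (simp add: hbar s_def C_def)
  have rate: "1 - h * \<mu> * c * (1 - s) / C = 1 - h * (\<mu> / M)" for h
    by (simp add: M_def)
  have bound: "f (x - h *\<^sub>R d) - f xstar
      \<le> (1 - h * \<mu> * c * (1 - s) / C)\<^sup>2 * (f x - f xstar)" if "0 \<le> h" "h \<le> hbar" for h
    unfolding rate using that
    by (intro relative_direction_contraction[OF assms(1-6) m mM gd]) (simp_all add: hb)
  have Lm0: "0 < L / m" "0 < \<mu> / M" using m mM \<open>0 < \<mu>\<close> \<open>\<mu> \<le> L\<close> by simp_all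
  have "\<kappa> = (L / m) / (\<mu> / M)"
    unfolding kappa m_def M_def s_def[symmetric] using pos \<open>0 < \<mu>\<close> by (simp add: field_simps)
  then have "(\<kappa> - 1) / (\<kappa> + 1) = ((L / m) / (\<mu> / M) - 1) / ((L / m) / (\<mu> / M) + 1)" by simp
  also have "\<dots> = 1 - hbar * (\<mu> / M)"
  proof -
    have "(a / b - 1) / (a / b + 1) = 1 - 2 / (a + b) * b" if "0 < a" "0 < b" for a b :: real
      using that by (simp add: divide_simps)
    from this[OF Lm0] show ?thesis unfolding hb .
  qed
  finally have last: "(\<kappa> - 1) / (\<kappa> + 1) = 1 - hbar * \<mu> * c * (1 - s) / C" unfolding rate .
  have "0 \<le> hbar" using Lm0 by (simp add: hb)
  then show ?thesis
    using bound bound[of hbar] by (simp add: last s_def C_def)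
qed

end
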